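(* Let $\mathcal{C}$ be a strongly right exact category. Then the following are equivalent: (i) $\mathcal{C}$ is weakly idempotent complete. (ii) If $i:A\to B$ and $p:B\to C$ are morphisms in $\mathcal{C}$ such that $pi$ is an inflation, then $i$ is an inflation.
   Context: A right exact category is an additive category endowed with a distinguished class of kernels (morphisms that are kernels of some morphism), called inflations, such that: [R0] the identity morphism $1_0:0\to 0$ is an inflation; [R1] the composition of any two inflations is an inflation; [R2] the pushout of any inflation along an arbitrary morphism exists and is again an inflation. It is strongly right exact if moreover: [R3] if $i:A\to B$ and $p:B\to C$ are morphisms such that $i$ has a cokernel and $pi$ is an inflation, then $i$ is an inflation. An additive category is weakly idempotent complete if every section (morphism with a left inverse) has a cokernel; equivalently, every retraction (morphism with a right inverse) has a kernel. *)

theory Defs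
  imports "HOL-Algebra.Group"
begin

section \<open>Categories\<close>

text \<open>
  The fields are total functions, meaningful only on objects, arrows and composable pairs;
  \<open>g \<cdot> f\<close> means \<open>f\<close> first, then \<open>g\<close>.
\<close>

record ('o, 'm) category_data =
  Obj :: "'o set"
  Arr :: "'m set"
  Dom :: "'m \<Rightarrow> 'o"
  Cod :: "'m \<Rightarrow> 'o"
  Id :: "'o \<Rightarrow> 'm"
  Comp :: "'m \<Rightarrow> 'm \<Rightarrow> 'm"  (infixl "\<cdot>\<index>" 70)

definition Hom :: "('o, 'm, 'z) category_data_scheme \<Rightarrow> 'o \<Rightarrow> 'o \<Rightarrow> 'm set" ("Hom\<index>")
  where "Hom\<^bsub>C\<^esub> A B = {f \<in> Arr C. Dom C f = A \<and> Cod C f = B}"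

locale category =
  fixes C :: "('o, 'm, 'z) category_data_scheme" (structure)
  assumes Dom_closed: "f \<in> Arr C \<Longrightarrow> Dom C f \<in> Obj C"
    and Cod_closed: "f \<in> Arr C \<Longrightarrow> Cod C f \<in> Obj C"
    and Id_closed: "A \<in> Obj C \<Longrightarrow> Id C A \<in> Hom A A"
    and Comp_closed: "f \<in> Hom A B \<Longrightarrow> g \<in> Hom B D \<Longrightarrow> g \<cdot> f \<in> Hom A D"
    and Comp_Id_left: "f \<in> Hom A B \<Longrightarrow> Id C B \<cdot> f = f"
    and Comp_Id_right: "f \<in> Hom A B \<Longrightarrow> f \<cdot> Id C A = f"
    and Comp_assoc: "f \<in> Hom A B \<Longrightarrow> g \<in> Hom B D \<Longrightarrow> h \<in> Hom D E
      \<Longrightarrow> (h \<cdot> g) \<cdot> f = h \<cdot> (g \<cdot> f)"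

definition is_zero_object :: "('o, 'm, 'z) category_data_scheme \<Rightarrow> 'o \<Rightarrow> bool" where
  "is_zero_object C Z \<longleftrightarrow> Z \<in> Obj C \<and>
     (\<forall>A\<in>Obj C. (\<exists>!f. f \<in> Hom\<^bsub>C\<^esub> A Z) \<and> (\<exists>!f. f \<in> Hom\<^bsub>C\<^esub> Z A))"

text \<open>
  \<open>is_pushout C i g i' g'\<close>: the square with sides \<open>i : A \<rightarrow> B\<close>, \<open>g : A \<rightarrow> A'\<close>, \<open>i' : A' \<rightarrow> B'\<close>,
  \<open>g' : B \<rightarrow> B'\<close> is a pushout; \<open>i'\<close> is then a pushout of \<open>i\<close> along \<open>g\<close>.
\<close>

definition is_pushout ::
  "('o, 'm, 'z) category_data_scheme \<Rightarrow> 'm \<Rightarrow> 'm \<Rightarrow> 'm \<Rightarrow> 'm \<Rightarrow> bool" where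
  "is_pushout C i g i' g' \<longleftrightarrow>
     (\<exists>A B A' B'. i \<in> Hom\<^bsub>C\<^esub> A B \<and> g \<in> Hom\<^bsub>C\<^esub> A A' \<and> i' \<in> Hom\<^bsub>C\<^esub> A' B' \<and> g' \<in> Hom\<^bsub>C\<^esub> B B' \<and>
        g' \<cdot>\<^bsub>C\<^esub> i = i' \<cdot>\<^bsub>C\<^esub> g \<and>
        (\<forall>X\<in>Obj C. \<forall>u\<in>Hom\<^bsub>C\<^esub> B X. \<forall>v\<in>Hom\<^bsub>C\<^esub> A' X. u \<cdot>\<^bsub>C\<^esub> i = v \<cdot>\<^bsub>C\<^esub> g \<longrightarrow>
           (\<exists>!w. w \<in> Hom\<^bsub>C\<^esub> B' X \<and> w \<cdot>\<^bsub>C\<^esub> g' = u \<and> w \<cdot>\<^bsub>C\<^esub> i' = v)))"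

definition is_section :: "('o, 'm, 'z) category_data_scheme \<Rightarrow> 'm \<Rightarrow> bool" where
  "is_section C s \<longleftrightarrow>
     (\<exists>A B. s \<in> Hom\<^bsub>C\<^esub> A B \<and> (\<exists>r\<in>Hom\<^bsub>C\<^esub> B A. r \<cdot>\<^bsub>C\<^esub> s = Id C A))"


section \<open>Additive categories\<close>

record ('o, 'm) additive_data = "('o, 'm) category_data" +
  Add :: "'m \<Rightarrow> 'm \<Rightarrow> 'm"  (infixl "\<oplus>\<index>" 65)
  Zero :: "'o \<Rightarrow> 'o \<Rightarrow> 'm"

definition hom_group :: "('o, 'm, 'z) additive_data_scheme \<Rightarrow> 'o \<Rightarrow> 'o \<Rightarrow> 'm monoid" where
  "hom_group C A B = \<lparr>carrier = Hom\<^bsub>C\<^esub> A B, mult = Add C, one = Zero C A B\<rparr>"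

locale preadditive_category = category C
  for C :: "('o, 'm, 'z) additive_data_scheme" (structure) +
  assumes hom_comm_group: "A \<in> Obj C \<Longrightarrow> B \<in> Obj C \<Longrightarrow> comm_group (hom_group C A B)"
    and Comp_Add_right: "f \<in> Hom A B \<Longrightarrow> f' \<in> Hom A B \<Longrightarrow> g \<in> Hom B D
      \<Longrightarrow> g \<cdot> (f \<oplus> f') = g \<cdot> f \<oplus> g \<cdot> f'"
    and Comp_Add_left: "f \<in> Hom A B \<Longrightarrow> g \<in> Hom B D \<Longrightarrow> g' \<in> Hom B D
      \<Longrightarrow> (g \<oplus> g') \<cdot> f = g \<cdot> f \<oplus> g' \<cdot> f"

text \<open>
  Biproduct diagrams as in Mac Lane; the mixed composites \<open>p\<^sub>1 \<cdot> j\<^sub>2\<close> and \<open>p\<^sub>2 \<cdot> j\<^sub>1\<close> vanish as a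
  consequence of the three equations.
\<close>

locale additive_category = preadditive_category C
  for C :: "('o, 'm, 'z) additive_data_scheme" (structure) +
  assumes zero_object: "\<exists>Z. is_zero_object C Z"
    and biproducts: "A \<in> Obj C \<Longrightarrow> B \<in> Obj C \<Longrightarrow>
      \<exists>S\<in>Obj C. \<exists>j\<^sub>1\<in>Hom A S. \<exists>j\<^sub>2\<in>Hom B S. \<exists>p\<^sub>1\<in>Hom S A. \<exists>p\<^sub>2\<in>Hom S B.
        p\<^sub>1 \<cdot> j\<^sub>1 = Id C A \<and> p\<^sub>2 \<cdot> j\<^sub>2 = Id C B \<and> (j\<^sub>1 \<cdot> p\<^sub>1) \<oplus> (j\<^sub>2 \<cdot> p\<^sub>2) = Id C S"

definition is_kernel :: "('o, 'm, 'z) additive_data_scheme \<Rightarrow> 'm \<Rightarrow> 'm \<Rightarrow> bool" where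
  "is_kernel C k f \<longleftrightarrow>
     (\<exists>K A B. k \<in> Hom\<^bsub>C\<^esub> K A \<and> f \<in> Hom\<^bsub>C\<^esub> A B \<and> f \<cdot>\<^bsub>C\<^esub> k = Zero C K B \<and>
        (\<forall>X\<in>Obj C. \<forall>g\<in>Hom\<^bsub>C\<^esub> X A. f \<cdot>\<^bsub>C\<^esub> g = Zero C X B \<longrightarrow>
           (\<exists>!h. h \<in> Hom\<^bsub>C\<^esub> X K \<and> k \<cdot>\<^bsub>C\<^esub> h = g)))"

definition is_cokernel :: "('o, 'm, 'z) additive_data_scheme \<Rightarrow> 'm \<Rightarrow> 'm \<Rightarrow> bool" where
  "is_cokernel C c f \<longleftrightarrow>
     (\<exists>A B Q. f \<in> Hom\<^bsub>C\<^esub> A B \<and> c \<in> Hom\<^bsub>C\<^esub> B Q \<and> c \<cdot>\<^bsub>C\<^esub> f = Zero C A Q \<and>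
        (\<forall>X\<in>Obj C. \<forall>g\<in>Hom\<^bsub>C\<^esub> B X. g \<cdot>\<^bsub>C\<^esub> f = Zero C A X \<longrightarrow>
           (\<exists>!h. h \<in> Hom\<^bsub>C\<^esub> Q X \<and> h \<cdot>\<^bsub>C\<^esub> c = g)))"

definition weakly_idempotent_complete :: "('o, 'm, 'z) additive_data_scheme \<Rightarrow> bool" where
  "weakly_idempotent_complete C \<longleftrightarrow> (\<forall>s. is_section C s \<longrightarrow> (\<exists>c. is_cokernel C c s))"


section \<open>Right exact categories\<close>

text \<open>
  Pushouts are determined only up to isomorphism, so \<open>R2_inflation\<close> speaks about every pushout of
  an inflation. In particular all isomorphisms are inflations and the class of inflations is closed
  under isomorphism.
\<close>

locale right_exact_category = additive_category C
  for C :: "('o, 'm, 'z) additive_data_scheme" (structure) +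
  fixes Infl :: "'m set"
  assumes inflation_kernel: "i \<in> Infl \<Longrightarrow> \<exists>f. is_kernel C i f"
    and R0: "is_zero_object C Z \<Longrightarrow> Id C Z \<in> Infl"
    and R1: "i \<in> Infl \<Longrightarrow> j \<in> Infl \<Longrightarrow> i \<in> Hom A B \<Longrightarrow> j \<in> Hom B D \<Longrightarrow> j \<cdot> i \<in> Infl"
    and R2_exists: "i \<in> Infl \<Longrightarrow> i \<in> Hom A B \<Longrightarrow> g \<in> Hom A A'
      \<Longrightarrow> \<exists>i' g'. is_pushout C i g i' g'"
    and R2_inflation: "i \<in> Infl \<Longrightarrow> is_pushout C i g i' g' \<Longrightarrow> i' \<in> Infl"

locale strongly_right_exact_category = right_exact_category C Infl
  for C :: "('o, 'm, 'z) additive_data_scheme" (structure) and Infl :: "'m set" +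
  assumes R3: "i \<in> Hom A B \<Longrightarrow> p \<in> Hom B D \<Longrightarrow> \<exists>c. is_cokernel C c i \<Longrightarrow> p \<cdot> i \<in> Infl
      \<Longrightarrow> i \<in> Infl"

end

theory Submission
  imports Defs
begin

text \<open>
  Suppose \<open>p \<cdot> i\<close> is an inflation and form the pushout of \<open>p \<cdot> i : A \<rightarrow> D\<close> along \<open>i : A \<rightarrow> B\<close>. The
  identity of \<open>D\<close> and \<open>p\<close> induce a retraction of its leg \<open>s\<close> out of \<open>D\<close>, so \<open>s\<close> is a section. If it
  has a cokernel then so has \<open>i\<close>, of which \<open>s\<close> is a pushout, and R3 applies. Conversely, identities
  are inflations, being pushouts of the identity of a zero object; thus (ii) makes every section an
  inflation, and the pushout of an inflation along the morphism to a zero object is a cokernel.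
\<close>

text \<open>\<open>is_pushout\<close> hides all four corners behind existential quantifiers. An
  arrow determines its domain and codomain, so typing \<open>i\<close> and \<open>g\<close> fixes
  three corners, and only the apex \<open>P\<close> has to be obtained.\<close>

lemma is_pushoutE:
  assumes "is_pushout C i g i' g'" "i \<in> Hom\<^bsub>C\<^esub> A B" "g \<in> Hom\<^bsub>C\<^esub> A A'"
  obtains P where "i' \<in> Hom\<^bsub>C\<^esub> A' P" "g' \<in> Hom\<^bsub>C\<^esub> B P" "g' \<cdot>\<^bsub>C\<^esub> i = i' \<cdot>\<^bsub>C\<^esub> g"
    "\<And>X u v. X \<in> Obj C \<Longrightarrow> u \<in> Hom\<^bsub>C\<^esub> B X \<Longrightarrow> v \<in> Hom\<^bsub>C\<^esub> A' X \<Longrightarrow> u \<cdot>\<^bsub>C\<^esub> i = v \<cdot>\<^bsub>C\<^esub> g \<Longrightarrow>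
       \<exists>!w. w \<in> Hom\<^bsub>C\<^esub> P X \<and> w \<cdot>\<^bsub>C\<^esub> g' = u \<and> w \<cdot>\<^bsub>C\<^esub> i' = v"
proof -
  obtain A1 B1 A1' P where P: "i \<in> Hom\<^bsub>C\<^esub> A1 B1" "g \<in> Hom\<^bsub>C\<^esub> A1 A1'" "i' \<in> Hom\<^bsub>C\<^esub> A1' P"
      "g' \<in> Hom\<^bsub>C\<^esub> B1 P" "g' \<cdot>\<^bsub>C\<^esub> i = i' \<cdot>\<^bsub>C\<^esub> g"
      "\<forall>X\<in>Obj C. \<forall>u\<in>Hom\<^bsub>C\<^esub> B1 X. \<forall>v\<in>Hom\<^bsub>C\<^esub> A1' X. u \<cdot>\<^bsub>C\<^esub> i = v \<cdot>\<^bsub>C\<^esub> g \<longrightarrow>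
         (\<exists>!w. w \<in> Hom\<^bsub>C\<^esub> P X \<and> w \<cdot>\<^bsub>C\<^esub> g' = u \<and> w \<cdot>\<^bsub>C\<^esub> i' = v)"
    using assms(1) unfolding is_pushout_def by blast
  have "B1 = B" "A1' = A'"
    using P(1,2) assms(2,3) by (auto simp: Hom_def)
  with P that[of P] show thesis by blast
qed

lemma is_cokernelE:
  assumes "is_cokernel C c f" "f \<in> Hom\<^bsub>C\<^esub> A B"
  obtains Q where "c \<in> Hom\<^bsub>C\<^esub> B Q" "c \<cdot>\<^bsub>C\<^esub> f = Zero C A Q"
    "\<And>X g. X \<in> Obj C \<Longrightarrow> g \<in> Hom\<^bsub>C\<^esub> B X \<Longrightarrow> g \<cdot>\<^bsub>C\<^esub> f = Zero C A X \<Longrightarrow>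
       \<exists>!h. h \<in> Hom\<^bsub>C\<^esub> Q X \<and> h \<cdot>\<^bsub>C\<^esub> c = g"
proof -
  obtain A1 B1 Q where Q: "f \<in> Hom\<^bsub>C\<^esub> A1 B1" "c \<in> Hom\<^bsub>C\<^esub> B1 Q" "c \<cdot>\<^bsub>C\<^esub> f = Zero C A1 Q"
      "\<forall>X\<in>Obj C. \<forall>g\<in>Hom\<^bsub>C\<^esub> B1 X. g \<cdot>\<^bsub>C\<^esub> f = Zero C A1 X \<longrightarrow>
         (\<exists>!h. h \<in> Hom\<^bsub>C\<^esub> Q X \<and> h \<cdot>\<^bsub>C\<^esub> c = g)"
    using assms(1) unfolding is_cokernel_def by blast
  have "A1 = A" "B1 = B"
    using Q(1) assms(2) by (auto simp: Hom_def)
  with Q that[of Q] show thesis by blast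
qed

context category
begin

lemma Hom_objects:
  assumes "f \<in> Hom A B"
  shows "A \<in> Obj C" "B \<in> Obj C"
  using assms Dom_closed Cod_closed by (auto simp: Hom_def)

end

context preadditive_category
begin

lemma Zero_closed: "A \<in> Obj C \<Longrightarrow> B \<in> Obj C \<Longrightarrow> Zero C A B \<in> Hom A B"
  using monoid.one_closed[OF comm_group.axioms(1)[THEN comm_monoid.axioms(1)], OF hom_comm_group]
  by (simp add: hom_group_def)

text \<open>Cancellation in the hom group. By distributivity, a composite with a zero morphism is
  idempotent under addition, so this gives both absorption laws below.\<close>

lemma Add_idem_imp_Zero:
  assumes "f \<in> Hom A B" "f \<oplus> f = f"
  shows "f = Zero C A B"
proof -
  interpret G: comm_group "hom_group C A B"
    using assms(1) by (intro hom_comm_group Hom_objects)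
  show ?thesis
    using assms G.r_cancel_one[of f f] by (simp add: hom_group_def)
qed

lemma Zero_Add_Zero:
  assumes "A \<in> Obj C" "B \<in> Obj C"
  shows "Zero C A B \<oplus> Zero C A B = Zero C A B"
proof -
  interpret G: comm_group "hom_group C A B"
    using assms by (rule hom_comm_group)
  show ?thesis
    using G.l_one[OF G.one_closed] by (simp add: hom_group_def)
qed

lemma Comp_Zero_right:
  assumes "A \<in> Obj C" "g \<in> Hom B D"
  shows "g \<cdot> Zero C A B = Zero C A D"
proof (rule Add_idem_imp_Zero)
  have B: "B \<in> Obj C" using assms(2) by (rule Hom_objects)
  show "g \<cdot> Zero C A B \<in> Hom A D"
    using Zero_closed[OF assms(1) B] assms(2) by (rule Comp_closed)
  show "g \<cdot> Zero C A B \<oplus> g \<cdot> Zero C A B = g \<cdot> Zero C A B"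
    using Comp_Add_right[OF _ _ assms(2)] Zero_closed[OF assms(1) B] Zero_Add_Zero[OF assms(1) B]
    by metis
qed

lemma Comp_Zero_left:
  assumes "D \<in> Obj C" "f \<in> Hom A B"
  shows "Zero C B D \<cdot> f = Zero C A D"
proof (rule Add_idem_imp_Zero)
  have B: "B \<in> Obj C" using assms(2) by (rule Hom_objects)
  show "Zero C B D \<cdot> f \<in> Hom A D"
    using assms(2) Zero_closed[OF B assms(1)] by (rule Comp_closed)
  show "Zero C B D \<cdot> f \<oplus> Zero C B D \<cdot> f = Zero C B D \<cdot> f"
    using Comp_Add_left[OF assms(2)] Zero_closed[OF B assms(1)] Zero_Add_Zero[OF B assms(1)]
    by metis
qed

lemma zero_object_Hom_unique:
  assumes "is_zero_object C Z" "f \<in> Hom Z A" "g \<in> Hom Z A"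
  shows "f = g"
  using assms Hom_objects(2)[OF assms(2)] unfolding is_zero_object_def by blast

text \<open>All morphisms out of \<open>Z\<close> are zero. Hence a cocone on \<open>f\<close> and
  \<open>g\<close> amounts to a morphism \<open>u\<close> out of \<open>B\<close> with
  \<open>u \<cdot> f\<close> zero, and the universal property of the pushout becomes that of a
  cokernel.\<close>

lemma pushout_to_zero_object_is_cokernel:
  assumes f: "f \<in> Hom A B" and Z: "is_zero_object C Z" and g: "g \<in> Hom A Z"
    and po: "is_pushout C f g i c"
  shows "is_cokernel C c f"
proof -
  obtain P where i: "i \<in> Hom Z P" and c: "c \<in> Hom B P" and sq: "c \<cdot> f = i \<cdot> g"
    and univ: "\<And>X u v. X \<in> Obj C \<Longrightarrow> u \<in> Hom B X \<Longrightarrow> v \<in> Hom Z X \<Longrightarrow> u \<cdot> f = v \<cdot> g \<Longrightarrow>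
       \<exists>!w. w \<in> Hom P X \<and> w \<cdot> c = u \<and> w \<cdot> i = v"
    using po f g by (rule is_pushoutE) blast
  have ZO: "Z \<in> Obj C" using Z by (simp add: is_zero_object_def)
  have P: "P \<in> Obj C" using i by (rule Hom_objects)
  have "i = Zero C Z P"
    using zero_object_Hom_unique[OF Z i] Zero_closed[OF ZO P] by blast
  then have cf: "c \<cdot> f = Zero C A P"
    using sq Comp_Zero_left[OF P g] by simp
  have "\<exists>!w. w \<in> Hom P X \<and> w \<cdot> c = u"
    if X: "X \<in> Obj C" and u: "u \<in> Hom B X" and uf: "u \<cdot> f = Zero C A X" for X u
  proof -
    \<comment> \<open>The second triangle of the pushout commutes for every \<open>w\<close>, so
      uniqueness is not lost when that condition is dropped.\<close>
    have "w \<cdot> i = Zero C Z X" if "w \<in> Hom P X" for w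
      using zero_object_Hom_unique[OF Z Comp_closed[OF i that]] Zero_closed[OF ZO X] by blast
    then show ?thesis
      using univ[OF X u Zero_closed[OF ZO X]] Comp_Zero_left[OF X g] uf by auto
  qed
  with f c cf show ?thesis
    unfolding is_cokernel_def by blast
qed

text \<open>A morphism out of \<open>B\<close> that kills \<open>i\<close> extends, by zero on
  \<open>D\<close>, to a unique morphism out of \<open>P\<close> that kills \<open>s\<close>, and
  this factors uniquely through \<open>q\<close>.\<close>

lemma cokernel_of_pushout:
  assumes j: "j \<in> Hom A D" and i: "i \<in> Hom A B" and po: "is_pushout C j i t s"
    and q: "is_cokernel C q s"
  shows "is_cokernel C (q \<cdot> t) i"
proof -
  obtain P where t: "t \<in> Hom B P" and s: "s \<in> Hom D P" and sq: "s \<cdot> j = t \<cdot> i"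
    and univ: "\<And>X u v. X \<in> Obj C \<Longrightarrow> u \<in> Hom D X \<Longrightarrow> v \<in> Hom B X \<Longrightarrow> u \<cdot> j = v \<cdot> i \<Longrightarrow>
       \<exists>!w. w \<in> Hom P X \<and> w \<cdot> s = u \<and> w \<cdot> t = v"
    using po j i by (rule is_pushoutE) blast
  obtain Q where qQ: "q \<in> Hom P Q" and qs: "q \<cdot> s = Zero C D Q"
    and couniv: "\<And>X g. X \<in> Obj C \<Longrightarrow> g \<in> Hom P X \<Longrightarrow> g \<cdot> s = Zero C D X \<Longrightarrow>
       \<exists>!h. h \<in> Hom Q X \<and> h \<cdot> q = g"
    using q s by (rule is_cokernelE) blast
  have Q: "Q \<in> Obj C" using qQ by (rule Hom_objects)
  have D: "D \<in> Obj C" using s by (rule Hom_objects)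
  have "(q \<cdot> t) \<cdot> i = (q \<cdot> s) \<cdot> j"
    by (simp add: Comp_assoc[OF i t qQ] Comp_assoc[OF j s qQ] sq)
  then have qti: "(q \<cdot> t) \<cdot> i = Zero C A Q"
    using qs Comp_Zero_left[OF Q j] by simp
  have "\<exists>!h. h \<in> Hom Q X \<and> h \<cdot> (q \<cdot> t) = g"
    if X: "X \<in> Obj C" and g: "g \<in> Hom B X" and gi: "g \<cdot> i = Zero C A X" for X g
  proof -
    have uw: "\<exists>!w. w \<in> Hom P X \<and> w \<cdot> s = Zero C D X \<and> w \<cdot> t = g"
      using univ[OF X Zero_closed[OF D X] g] Comp_Zero_left[OF X j] gi by simp
    then obtain w where w: "w \<in> Hom P X" "w \<cdot> s = Zero C D X" "w \<cdot> t = g" by blast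
    \<comment> \<open>Since \<open>h \<cdot> q\<close> kills \<open>s\<close>, it equals
      \<open>w\<close> as soon as both agree after \<open>t\<close>. Existence and uniqueness of
      \<open>h\<close> thus carry over from \<open>q\<close> to \<open>q \<cdot> t\<close>.\<close>
    have "h \<cdot> (q \<cdot> t) = g \<longleftrightarrow> h \<cdot> q = w" if h: "h \<in> Hom Q X" for h
    proof -
      have "(h \<cdot> q) \<cdot> s = Zero C D X"
        using Comp_assoc[OF s qQ h] qs Comp_Zero_right[OF D h] by simp
      then show ?thesis
        using uw w Comp_closed[OF qQ h] Comp_assoc[OF t qQ h] by metis
    qed
    with couniv[OF X w(1,2)] show ?thesis by metis
  qed
  with i Comp_closed[OF t qQ] qti show ?thesis
    unfolding is_cokernel_def by blast
qed

end

context right_exact_category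
begin

text \<open>R0 covers only zero objects; R2 moves the identity of \<open>Z\<close> along
  \<open>Z \<rightarrow> A\<close>.\<close>

lemma Id_inflation:
  assumes A: "A \<in> Obj C"
  shows "Id C A \<in> Infl"
proof -
  obtain Z where Z: "is_zero_object C Z" using zero_object by blast
  then have ZO: "Z \<in> Obj C" by (simp add: is_zero_object_def)
  have z: "Zero C Z A \<in> Hom Z A" using ZO A by (rule Zero_closed)
  have "is_pushout C (Id C Z) (Zero C Z A) (Id C A) (Zero C Z A)"
    unfolding is_pushout_def
  proof (intro exI conjI ballI impI)
    show "Zero C Z A \<cdot> Id C Z = Id C A \<cdot> Zero C Z A"
      using z by (simp add: Comp_Id_left Comp_Id_right)
    fix X u v
    assume u: "u \<in> Hom Z X" and v: "v \<in> Hom A X"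
    \<comment> \<open>Both morphisms start at \<open>Z\<close>, so \<open>u\<close> imposes no
      condition and the mediating morphism is \<open>v\<close> itself.\<close>
    have "v \<cdot> Zero C Z A = u"
      using zero_object_Hom_unique[OF Z Comp_closed[OF z v] u] .
    then show "\<exists>!w. w \<in> Hom A X \<and> w \<cdot> Zero C Z A = u \<and> w \<cdot> Id C A = v"
      using v Comp_Id_right by metis
  qed (use z A ZO Id_closed in auto)
  with R0[OF Z] show ?thesis by (rule R2_inflation)
qed

lemma inflation_has_cokernel:
  assumes "f \<in> Infl" "f \<in> Hom A B"
  shows "\<exists>c. is_cokernel C c f"
proof -
  obtain Z where Z: "is_zero_object C Z" using zero_object by blast
  then have "Z \<in> Obj C" by (simp add: is_zero_object_def)
  then have "Zero C A Z \<in> Hom A Z"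
    using Hom_objects(1)[OF assms(2)] by (intro Zero_closed)
  with R2_exists[OF assms this] pushout_to_zero_object_is_cokernel[OF assms(2) Z]
  show ?thesis by blast
qed

text \<open>This provides the cokernel that R3 demands of \<open>i\<close>.\<close>

lemma inflation_factor_has_cokernel:
  assumes wic: "weakly_idempotent_complete C"
    and i: "i \<in> Hom A B" and p: "p \<in> Hom B D" and pi: "p \<cdot> i \<in> Infl"
  shows "\<exists>c. is_cokernel C c i"
proof -
  have piH: "p \<cdot> i \<in> Hom A D" using i p by (rule Comp_closed)
  have D: "D \<in> Obj C" using p by (rule Hom_objects)
  have one: "Id C D \<in> Hom D D" using D by (rule Id_closed)
  \<comment> \<open>Here \<open>t\<close> starts at \<open>B\<close> and is the leg opposite
    \<open>p \<cdot> i\<close>, while \<open>s\<close> starts at \<open>D\<close> and is opposite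
    \<open>i\<close>. The section will be \<open>s\<close>.\<close>
  obtain t s where po: "is_pushout C (p \<cdot> i) i t s"
    using R2_exists[OF pi piH i] by blast
  obtain P where s: "s \<in> Hom D P"
    and univ: "\<And>X u v. X \<in> Obj C \<Longrightarrow> u \<in> Hom D X \<Longrightarrow> v \<in> Hom B X \<Longrightarrow> u \<cdot> (p \<cdot> i) = v \<cdot> i \<Longrightarrow>
       \<exists>!w. w \<in> Hom P X \<and> w \<cdot> s = u \<and> w \<cdot> t = v"
    using po piH i by (rule is_pushoutE) blast
  \<comment> \<open>The pair of the identity of \<open>D\<close> and \<open>p\<close> is a cocone,
    as both composites from \<open>A\<close> are \<open>p \<cdot> i\<close>. Its mediating morphism
    is the retraction.\<close>
  obtain r where "r \<in> Hom P D" "r \<cdot> s = Id C D"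
    using univ[OF D one p] Comp_Id_left[OF piH] by blast
  with s have "is_section C s" unfolding is_section_def by blast
  with wic obtain q where "is_cokernel C q s"
    unfolding weakly_idempotent_complete_def by blast
  with cokernel_of_pushout[OF piH i po] show ?thesis by blast
qed

end

theorem proposition6p4:
  fixes C :: "('o, 'm, 'z) additive_data_scheme" and Infl :: "'m set"
  assumes "strongly_right_exact_category C Infl"
  shows "weakly_idempotent_complete C \<longleftrightarrow>
    (\<forall>A\<in>Obj C. \<forall>B\<in>Obj C. \<forall>D\<in>Obj C. \<forall>i\<in>Hom\<^bsub>C\<^esub> A B. \<forall>p\<in>Hom\<^bsub>C\<^esub> B D.
       p \<cdot>\<^bsub>C\<^esub> i \<in> Infl \<longrightarrow> i \<in> Infl)"
proof -
  interpret strongly_right_exact_category C Infl by (rule assms)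
  show ?thesis
  proof
    assume "weakly_idempotent_complete C"
    then show "\<forall>A\<in>Obj C. \<forall>B\<in>Obj C. \<forall>D\<in>Obj C. \<forall>i\<in>Hom\<^bsub>C\<^esub> A B. \<forall>p\<in>Hom\<^bsub>C\<^esub> B D.
        p \<cdot>\<^bsub>C\<^esub> i \<in> Infl \<longrightarrow> i \<in> Infl"
      using inflation_factor_has_cokernel R3 by blast
  next
    assume cancel: "\<forall>A\<in>Obj C. \<forall>B\<in>Obj C. \<forall>D\<in>Obj C. \<forall>i\<in>Hom\<^bsub>C\<^esub> A B. \<forall>p\<in>Hom\<^bsub>C\<^esub> B D.
        p \<cdot>\<^bsub>C\<^esub> i \<in> Infl \<longrightarrow> i \<in> Infl"
    show "weakly_idempotent_complete C"
      unfolding weakly_idempotent_complete_def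
    proof (intro allI impI)
      fix s
      assume "is_section C s"
      then obtain A B r where s: "s \<in> Hom\<^bsub>C\<^esub> A B" and r: "r \<in> Hom\<^bsub>C\<^esub> B A"
        and rs: "r \<cdot>\<^bsub>C\<^esub> s = Id C A"
        unfolding is_section_def by blast
      \<comment> \<open>The cancellation property is applied with the retraction \<open>r\<close> in
        the place of \<open>p\<close>.\<close>
      have "r \<cdot>\<^bsub>C\<^esub> s \<in> Infl"
        using rs Id_inflation Hom_objects(1)[OF s] by simp
      then have "s \<in> Infl"
        using cancel s r Hom_objects[OF s] by blast
      then show "\<exists>c. is_cokernel C c s"
        using s by (rule inflation_has_cokernel)
    qed
  qed
qed

end
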